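(* Let $N$ be a timelike ruled surface of type $N_-$ in $\mathbb{R}_1^3$, $\vec r(s,v)=\vec c(s)+v\vec q(s)$, $s\in I$, with timelike striction curve $\vec c$, Frenet frame $\{\vec q,\vec h,\vec a\}$ and angle function $\theta$. Then the striction curve $\vec c$ is a geodesic on $N$ if and only if $\theta$ is constant.
   Context: $\mathbb{R}_1^3$ is Minkowski 3-space with metric $\langle\cdot,\cdot\rangle=-dx_1^2+dx_2^2+dx_3^2$. A nonzero vector $\vec v$ is timelike if $\langle\vec v,\vec v\rangle<0$, null if $\langle\vec v,\vec v\rangle=0$, spacelike if $\langle\vec v,\vec v\rangle>0$. Setting. All functions are smooth on an open interval $I$. A timelike ruled surface of type $N_-$ with timelike striction curve is $\vec r(s,v)=\vec c(s)+v\vec q(s)$, with ruling direction $\vec q$ unit timelike, where $\vec c$ is its striction curve, a timelike curve parametrized by arc length $s$. It has a Frenet frame $\{\vec q,\vec h,\vec a\}$ of mutually orthogonal vectors, $\langle\vec q,\vec q\rangle=-1$, $\langle\vec h,\vec h\rangle=\langle\vec a,\vec a\rangle=1$ ($\vec h$ is the central normal, i.e. the surface normal along $\vec c$; $\vec a$ the central tangent), with $\vec q\,'=k_1\vec h$, $\vec h'=k_1\vec q+k_2\vec a$, $\vec a'=-k_2\vec h$ (prime is $d/ds$) for functions $k_1,k_2$. Standing assumption: the derivatives of the frame vectors are non-null and $N$ is non-cylindrical; in particular $k_1\neq0$ and $k_1^2\neq k_2^2$ everywhere. The unit tangent of $\vec c$ is $\vec c\,'=\vec t=\cosh\theta\,\vec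 q+\sinh\theta\,\vec a$ for a real function $\theta$ (the hyperbolic angle between $\vec t$ and $\vec q$). The curve $\vec c$ is a geodesic on $N$ if $\vec h$ and $\vec c\,''$ are linearly dependent at every $s\in I$. *)

theory Defs
  imports "HOL-Analysis.Analysis"
begin

definition mink :: "real^3 \<Rightarrow> real^3 \<Rightarrow> real" where
  "mink u v = - (u $ 1 * v $ 1) + u $ 2 * v $ 2 + u $ 3 * v $ 3"

definition timelike :: "real^3 \<Rightarrow> bool" where
  "timelike v \<longleftrightarrow> v \<noteq> 0 \<and> mink v v < 0"

(* The zero vector has no causal character; in particular it is not null. *)
definition null_vec :: "real^3 \<Rightarrow> bool" where
  "null_vec v \<longleftrightarrow> v \<noteq> 0 \<and> mink v v = 0"

definition open_interval :: "real set \<Rightarrow> bool" where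
  "open_interval I \<longleftrightarrow> open I \<and> is_interval I \<and> I \<noteq> {}"

abbreviation vderiv :: "(real \<Rightarrow> 'a::real_normed_vector) \<Rightarrow> real \<Rightarrow> 'a" where
  "vderiv f \<equiv> (\<lambda>s. vector_derivative f (at s))"

(* C^infinity on an open set: all iterated derivatives exist there. *)
definition smooth_on :: "real set \<Rightarrow> (real \<Rightarrow> 'a::real_normed_vector) \<Rightarrow> bool" where
  "smooth_on I f \<longleftrightarrow> (\<forall>n. \<forall>s\<in>I. (vderiv ^^ n) f differentiable (at s))"

(* Dependence of the pair (u, v). The library's "dependent {u, v}" is about the set, and would
   regard a pair with u = v as independent when u is nonzero. *)
definition lin_dep :: "'a::real_vector \<Rightarrow> 'a \<Rightarrow> bool" where
  "lin_dep u v \<longleftrightarrow> (\<exists>\<alpha> \<beta>. (\<alpha> \<noteq> 0 \<or> \<beta> \<noteq> 0) \<and> \<alpha> *\<^sub>R u + \<beta> *\<^sub>R v = 0)"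

definition ruled_surface :: "(real \<Rightarrow> real^3) \<Rightarrow> (real \<Rightarrow> real^3) \<Rightarrow> real \<Rightarrow> real \<Rightarrow> real^3" where
  "ruled_surface c q s v = c s + v *\<^sub>R q s"

definition partial_s :: "(real \<Rightarrow> real \<Rightarrow> real^3) \<Rightarrow> real \<Rightarrow> real \<Rightarrow> real^3" where
  "partial_s r s v = vector_derivative (\<lambda>x. r x v) (at s)"

definition partial_v :: "(real \<Rightarrow> real \<Rightarrow> real^3) \<Rightarrow> real \<Rightarrow> real \<Rightarrow> real^3" where
  "partial_v r s v = vector_derivative (\<lambda>y. r s y) (at v)"

(* The induced metric is Lorentzian (first fundamental form of negative determinant)
   at every regular point; a ruled surface may have singular points. *)
definition timelike_surface :: "real set \<Rightarrow> (real \<Rightarrow> real \<Rightarrow> real^3) \<Rightarrow> bool" where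
  "timelike_surface I r \<longleftrightarrow> (\<forall>s\<in>I. \<forall>v. \<not> lin_dep (partial_s r s v) (partial_v r s v) \<longrightarrow>
     mink (partial_s r s v) (partial_s r s v) * mink (partial_v r s v) (partial_v r s v)
       - (mink (partial_s r s v) (partial_v r s v))\<^sup>2 < 0)"

definition surface_normal :: "(real \<Rightarrow> real \<Rightarrow> real^3) \<Rightarrow> real \<Rightarrow> real \<Rightarrow> real^3 \<Rightarrow> bool" where
  "surface_normal r s v n \<longleftrightarrow>
     n \<noteq> 0 \<and> mink n (partial_s r s v) = 0 \<and> mink n (partial_v r s v) = 0"

(* The striction curve of the ruled surface f(s) + v q(s) with arbitrary base curve f. *)
definition striction_curve :: "(real \<Rightarrow> real^3) \<Rightarrow> (real \<Rightarrow> real^3) \<Rightarrow> real \<Rightarrow> real^3" where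
  "striction_curve f q s =
     f s - (mink (vderiv f s) (vderiv q s) / mink (vderiv q s) (vderiv q s)) *\<^sub>R q s"

definition non_cylindrical :: "real set \<Rightarrow> (real \<Rightarrow> real^3) \<Rightarrow> bool" where
  "non_cylindrical I q \<longleftrightarrow> (\<forall>s\<in>I. vderiv q s \<noteq> 0)"

(* Unit speed: for a timelike curve, arc length is the integral of sqrt (- mink c' c'). *)
definition unit_speed_timelike_curve :: "real set \<Rightarrow> (real \<Rightarrow> real^3) \<Rightarrow> bool" where
  "unit_speed_timelike_curve I c \<longleftrightarrow>
     (\<forall>s\<in>I. timelike (vderiv c s) \<and> sqrt (- mink (vderiv c s) (vderiv c s)) = 1)"

(* Timelike ruled surface of type N_- whose base curve c is its striction curve,
   timelike and parametrized by arc length. *)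
definition ruled_surface_N_minus ::
    "real set \<Rightarrow> (real \<Rightarrow> real^3) \<Rightarrow> (real \<Rightarrow> real^3) \<Rightarrow> bool" where
  "ruled_surface_N_minus I c q \<longleftrightarrow>
     smooth_on I c \<and> smooth_on I q \<and>
     timelike_surface I (ruled_surface c q) \<and>
     (\<forall>s\<in>I. timelike (q s) \<and> mink (q s) (q s) = -1) \<and>
     non_cylindrical I q \<and>
     (\<forall>s\<in>I. striction_curve c q s = c s) \<and>
     unit_speed_timelike_curve I c"

definition Frenet_frame ::
    "real set \<Rightarrow> (real \<Rightarrow> real^3) \<Rightarrow> (real \<Rightarrow> real^3) \<Rightarrow> (real \<Rightarrow> real^3) \<Rightarrow> (real \<Rightarrow> real^3) \<Rightarrow>
     (real \<Rightarrow> real) \<Rightarrow> (real \<Rightarrow> real) \<Rightarrow> bool" where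
  "Frenet_frame I c q h a k1 k2 \<longleftrightarrow>
     smooth_on I h \<and> smooth_on I a \<and> smooth_on I k1 \<and> smooth_on I k2 \<and>
     (\<forall>s\<in>I.
        mink (q s) (q s) = -1 \<and> mink (h s) (h s) = 1 \<and> mink (a s) (a s) = 1 \<and>
        mink (q s) (h s) = 0 \<and> mink (q s) (a s) = 0 \<and> mink (h s) (a s) = 0 \<and>
        surface_normal (ruled_surface c q) s 0 (h s) \<and>
        vderiv q s = k1 s *\<^sub>R h s \<and>
        vderiv h s = k1 s *\<^sub>R q s + k2 s *\<^sub>R a s \<and>
        vderiv a s = - k2 s *\<^sub>R h s)"

(* Together with non_cylindrical this gives k1 \<noteq> 0 and k1\<^sup>2 \<noteq> k2\<^sup>2; k2 may vanish. *)
definition non_null_frame_derivs ::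
    "real set \<Rightarrow> (real \<Rightarrow> real^3) \<Rightarrow> (real \<Rightarrow> real^3) \<Rightarrow> (real \<Rightarrow> real^3) \<Rightarrow> bool" where
  "non_null_frame_derivs I q h a \<longleftrightarrow>
     (\<forall>s\<in>I. \<not> null_vec (vderiv q s) \<and> \<not> null_vec (vderiv h s) \<and> \<not> null_vec (vderiv a s))"

definition angle_function ::
    "real set \<Rightarrow> (real \<Rightarrow> real^3) \<Rightarrow> (real \<Rightarrow> real^3) \<Rightarrow> (real \<Rightarrow> real^3) \<Rightarrow> (real \<Rightarrow> real) \<Rightarrow> bool" where
  "angle_function I c q a \<theta> \<longleftrightarrow> smooth_on I \<theta> \<and>
     (\<forall>s\<in>I. vderiv c s = cosh (\<theta> s) *\<^sub>R q s + sinh (\<theta> s) *\<^sub>R a s)"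

definition geodesic_on_surface :: "real set \<Rightarrow> (real \<Rightarrow> real^3) \<Rightarrow> (real \<Rightarrow> real^3) \<Rightarrow> bool" where
  "geodesic_on_surface I c h \<longleftrightarrow> (\<forall>s\<in>I. lin_dep (h s) (vderiv (vderiv c) s))"

end

theory Submission
  imports Defs
begin

text \<open>Differentiating \<open>c' = cosh \<theta> q + sinh \<theta> a\<close> with the Frenet equations gives
  \<open>c'' = \<theta>' (sinh \<theta> q + cosh \<theta> a) + (k1 cosh \<theta> - k2 sinh \<theta>) h\<close>. The \<open>a\<close>-component
  \<open>\<theta>' cosh \<theta>\<close> vanishes exactly when \<open>\<theta>'\<close> does, so \<open>c''\<close> is proportional to \<open>h\<close> everywhere
  iff \<open>\<theta>' = 0\<close> on the interval.\<close>

lemma mink_add_left: "mink (u + v) w = mink u w + mink v w"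
  by (simp add: mink_def algebra_simps)

lemma mink_scaleR_left: "mink (r *\<^sub>R u) w = r * mink u w"
  by (simp add: mink_def algebra_simps)

lemma mink_zero_left [simp]: "mink 0 w = 0"
  by (simp add: mink_def)

lemma smooth_on_has_vector_derivative:
  assumes "smooth_on I f" "s \<in> I"
  shows "(f has_vector_derivative vderiv f s) (at s)"
  \<comment> \<open>This is the case \<open>n = 0\<close> of smoothness, where the iterate is
    \<open>f\<close> itself.\<close>
  using assms vector_derivative_works unfolding smooth_on_def by (metis funpow_0)

text \<open>By the product rule: \<open>q\<close> and \<open>a\<close> both have derivatives along
  \<open>h\<close>, so every \<open>q\<close> or \<open>a\<close> term of the result comes from
  differentiating a coefficient and carries the factor \<open>\<theta>'\<close>.\<close>

lemma vderiv_hyperbolic_combination: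
  fixes q h a c :: "real \<Rightarrow> 'a::real_normed_vector" and \<theta> :: "real \<Rightarrow> real"
  assumes "open I" "s \<in> I"
    and c: "\<And>x. x \<in> I \<Longrightarrow> vderiv c x = cosh (\<theta> x) *\<^sub>R q x + sinh (\<theta> x) *\<^sub>R a x"
    and \<theta>: "(\<theta> has_vector_derivative \<theta>') (at s)"
    and q: "(q has_vector_derivative k1 *\<^sub>R h s) (at s)"
    and a: "(a has_vector_derivative - k2 *\<^sub>R h s) (at s)"
  shows "vderiv (vderiv c) s =
    \<theta>' *\<^sub>R (sinh (\<theta> s) *\<^sub>R q s + cosh (\<theta> s) *\<^sub>R a s)
      + (k1 * cosh (\<theta> s) - k2 * sinh (\<theta> s)) *\<^sub>R h s"
proof -
  have \<theta>D: "(\<theta> has_real_derivative \<theta>') (at s)"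
    using \<theta> by (simp add: has_real_derivative_iff_has_vector_derivative)
  have "((\<lambda>x. cosh (\<theta> x) *\<^sub>R q x + sinh (\<theta> x) *\<^sub>R a x) has_vector_derivative
      (cosh (\<theta> s) *\<^sub>R (k1 *\<^sub>R h s) + (sinh (\<theta> s) * \<theta>') *\<^sub>R q s)
      + (sinh (\<theta> s) *\<^sub>R (- k2 *\<^sub>R h s) + (cosh (\<theta> s) * \<theta>') *\<^sub>R a s)) (at s)"
    by (intro has_vector_derivative_add has_vector_derivative_scaleR q a)
      (auto intro!: derivative_eq_intros \<theta>D)
  then have "(vderiv c has_vector_derivative
      (cosh (\<theta> s) *\<^sub>R (k1 *\<^sub>R h s) + (sinh (\<theta> s) * \<theta>') *\<^sub>R q s)
      + (sinh (\<theta> s) *\<^sub>R (- k2 *\<^sub>R h s) + (cosh (\<theta> s) * \<theta>') *\<^sub>R a s)) (at s)"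
    \<comment> \<open>The formula for \<open>vderiv c\<close> is known only on \<open>I\<close>;
      openness makes it hold near \<open>s\<close>, which is enough to differentiate it
      there.\<close>
    by (rule has_vector_derivative_transform_within_open[where S = I]) (use assms in auto)
  then show ?thesis
    by (simp add: vector_derivative_at algebra_simps)
qed

text \<open>Pairing with \<open>a\<close> kills \<open>q\<close> and \<open>h\<close> and leaves the
  coefficient \<open>d * cosh t\<close>, where \<open>cosh t\<close> never vanishes.\<close>

lemma lin_dep_iff_zero_component:
  assumes "mink h h = 1" "mink q a = 0" "mink h a = 0" "mink a a = 1"
  shows "lin_dep h (d *\<^sub>R (sinh t *\<^sub>R q + cosh t *\<^sub>R a) + m *\<^sub>R h) \<longleftrightarrow> d = 0"
proof
  assume "lin_dep h (d *\<^sub>R (sinh t *\<^sub>R q + cosh t *\<^sub>R a) + m *\<^sub>R h)"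
  then obtain \<alpha> \<beta> where nz: "\<alpha> \<noteq> 0 \<or> \<beta> \<noteq> 0"
    and eq: "\<alpha> *\<^sub>R h + \<beta> *\<^sub>R (d *\<^sub>R (sinh t *\<^sub>R q + cosh t *\<^sub>R a) + m *\<^sub>R h) = 0"
    unfolding lin_dep_def by blast
  \<comment> \<open>Otherwise \<open>\<alpha>\<close> is nonzero and \<open>h\<close> would be the
    zero vector, against \<open>mink h h = 1\<close>.\<close>
  have "\<beta> \<noteq> 0"
    using nz eq assms(1) by auto
  moreover have "\<beta> * (d * cosh t) = 0"
    using arg_cong[OF eq, of "\<lambda>x. mink x a"] assms
    by (simp add: mink_add_left mink_scaleR_left)
  ultimately show "d = 0"
    by simp
next
  assume "d = 0"
  \<comment> \<open>With \<open>d = 0\<close> the second vector is \<open>m *\<^sub>R h\<close>, so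
    the coefficients -m and 1 give a relation, nontrivial even if m = 0.\<close>
  then show "lin_dep h (d *\<^sub>R (sinh t *\<^sub>R q + cosh t *\<^sub>R a) + m *\<^sub>R h)"
    unfolding lin_dep_def by (intro exI[of _ "-m"] exI[of _ 1]) simp
qed

text \<open>Openness serves the forward direction, since \<open>vderiv\<close> is a two-sided
  derivative on the whole line; convexity of the interval serves the converse, which fails on
  disconnected sets.\<close>

lemma constant_on_iff_vderiv_zero:
  fixes f :: "real \<Rightarrow> real"
  assumes "open I" "is_interval I" "smooth_on I f"
  shows "f constant_on I \<longleftrightarrow> (\<forall>s\<in>I. vderiv f s = 0)"
proof
  assume "f constant_on I"
  then obtain k where k: "\<And>s. s \<in> I \<Longrightarrow> f s = k"
    unfolding constant_on_def by blast
  show "\<forall>s\<in>I. vderiv f s = 0"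
  proof
    fix s assume "s \<in> I"
    have "(f has_vector_derivative 0) (at s)"
      by (rule has_vector_derivative_transform_within_open[OF has_vector_derivative_const assms(1)])
        (use k \<open>s \<in> I\<close> in auto)
    then show "vderiv f s = 0"
      by (rule vector_derivative_at)
  qed
next
  assume zero: "\<forall>s\<in>I. vderiv f s = 0"
  have "\<exists>k. \<forall>s\<in>I. f s = k"
  proof (rule has_vector_derivative_zero_constant)
    show "convex I"
      using assms(2) by (simp add: is_interval_convex_1)
    show "(f has_vector_derivative 0) (at s within I)" if "s \<in> I" for s
      using smooth_on_has_vector_derivative[OF assms(3) that] zero that
      by (auto intro: has_vector_derivative_at_within)
  qed blast
  then show "f constant_on I"
    unfolding constant_on_def .
qed

theorem theorem3p2:
  fixes I :: "real set"
    and c q h a :: "real \<Rightarrow> real^3"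
    and k1 k2 \<theta> :: "real \<Rightarrow> real"
  assumes "open_interval I"
    and "ruled_surface_N_minus I c q"
    and "Frenet_frame I c q h a k1 k2"
    and "non_null_frame_derivs I q h a"
    and "angle_function I c q a \<theta>"
  shows "geodesic_on_surface I c h \<longleftrightarrow> \<theta> constant_on I"
proof -
  have I: "open I" "is_interval I"
    using assms(1) by (auto simp: open_interval_def)
  have smooth: "smooth_on I q" "smooth_on I a" "smooth_on I \<theta>"
    using assms(2,3,5)
    by (auto simp: ruled_surface_N_minus_def Frenet_frame_def angle_function_def)
  have c': "vderiv c s = cosh (\<theta> s) *\<^sub>R q s + sinh (\<theta> s) *\<^sub>R a s" if "s \<in> I" for s
    using assms(5) that by (simp add: angle_function_def)
  \<comment> \<open>The geodesic condition is pointwise, so it is compared with the vanishing of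
    \<open>vderiv \<theta>\<close> at each \<open>s\<close> separately; the interval enters only
    when passing to constancy.\<close>
  have "lin_dep (h s) (vderiv (vderiv c) s) \<longleftrightarrow> vderiv \<theta> s = 0" if s: "s \<in> I" for s
  proof -
    have frame: "mink (h s) (h s) = 1" "mink (q s) (a s) = 0" "mink (h s) (a s) = 0"
        "mink (a s) (a s) = 1"
      and q': "vderiv q s = k1 s *\<^sub>R h s" and a': "vderiv a s = - k2 s *\<^sub>R h s"
      using assms(3) s by (auto simp: Frenet_frame_def)
    have "vderiv (vderiv c) s =
        vderiv \<theta> s *\<^sub>R (sinh (\<theta> s) *\<^sub>R q s + cosh (\<theta> s) *\<^sub>R a s)
          + (k1 s * cosh (\<theta> s) - k2 s * sinh (\<theta> s)) *\<^sub>R h s"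
      using smooth[THEN smooth_on_has_vector_derivative, OF s] q' a'
      by (intro vderiv_hyperbolic_combination[OF I(1) s c']) simp_all
    then show ?thesis
      using lin_dep_iff_zero_component[OF frame] by simp
  qed
  then show ?thesis
    using constant_on_iff_vderiv_zero[OF I smooth(3)] by (simp add: geodesic_on_surface_def)
qed

end
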